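(* For every BPPS instance, every feasible solution $(x,y,z)$ of the integer linear program $\mathrm{ILP}_{\mathrm N}$ satisfies the Minimum Bins Inequality $$\sum_{b\in\mathcal B}z_b\ \ge\ \left\lceil\frac{\sum_{i\in\mathcal I}w_i+\sum_{c\in\mathcal C}\gamma_c\,s_c}{d}\right\rceil .$$
   Context: Bin Packing Problem with Setups (BPPS). An instance consists of: a bin capacity $d\in\mathbb Z_{\ge1}$; items $\mathcal I=\{1,\dots,n\}$ with weights $w_i\in\mathbb Z_{\ge1}$; classes $\mathcal C=\{1,\dots,m\}$ and a partition $\{\mathcal I_1,\dots,\mathcal I_m\}$ of $\mathcal I$ into (nonempty) classes; for each class $c$ a setup weight $s_c\in\mathbb Z_{\ge0}$ and a setup cost $f_c\in\mathbb Z_{\ge0}$; a bin cost $r\in\mathbb Z_{\ge1}$. It is assumed that $w_i+s_c\le d$ for all $c\in\mathcal C$, $i\in\mathcal I_c$, and that the items cannot all be packed in a single bin, i.e. $\sum_{i\in\mathcal I}w_i+\sum_{c\in\mathcal C}s_c>d$. For $S\subseteq\mathcal I$ let $\mathcal C(S)=\{c\in\mathcal C: S\cap\mathcal I_c\neq\emptyset\}$. A packing pattern is a subset $S\subseteq\mathcal I$ with $\sum_{i\in S}w_i+\sum_{c\in\mathcal C(S)}s_c\le d$. A feasible BPPS solution is a partition $\mathcal S$ of $\mathcal I$ into (nonempty) packing patterns (used bins); its cost is $r|\mathcal S|+\sum_{S\in\mathcal S}\sum_{c\in\mathcal C(S)}f_c$, to be minimized. For $c\in\mathcal C$ let $\gamma_c=\left\lceil\frac{\sum_{i\in\mathcal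 I_c}w_i}{d-s_c}\right\rceil$. Let $k\in\mathbb Z_{\ge1}$ be an upper bound on the number of bins used in any optimal BPPS solution and $\mathcal B=\{1,\dots,k\}$. The integer linear program $\mathrm{ILP}_{\mathrm N}$ is: minimize $\sum_{b\in\mathcal B}\big(r z_b+\sum_{c\in\mathcal C}f_c y_{cb}\big)$ subject to - $\sum_{b\in\mathcal B}x_{ib}=1$ for all $i\in\mathcal I$; - $\sum_{i\in\mathcal I}w_ix_{ib}+\sum_{c\in\mathcal C}s_cy_{cb}\le d\,z_b$ for all $b\in\mathcal B$; - $x_{ib}\le y_{cb}$ for all $c\in\mathcal C$, $i\in\mathcal I_c$, $b\in\mathcal B$; - $x_{ib},y_{cb},z_b\in\{0,1\}$ for all $i\in\mathcal I,c\in\mathcal C,b\in\mathcal B$. *)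

theory Defs
  imports Complex_Main "HOL-Library.Disjoint_Sets"
begin

record bpps =
  capacity :: int
  num_items :: nat
  weight :: "nat \<Rightarrow> int"
  num_classes :: nat
  class_items :: "nat \<Rightarrow> nat set"
  setup_weight :: "nat \<Rightarrow> int"
  setup_cost :: "nat \<Rightarrow> int"
  bin_cost :: int

definition items :: "bpps \<Rightarrow> nat set" where
  "items P = {1..num_items P}"

definition classes :: "bpps \<Rightarrow> nat set" where
  "classes P = {1..num_classes P}"

definition bpps_instance :: "bpps \<Rightarrow> bool" where
  "bpps_instance P \<longleftrightarrow>
     capacity P \<ge> 1 \<and>
     (\<forall>i\<in>items P. weight P i \<ge> 1) \<and>
     (\<Union>c\<in>classes P. class_items P c) = items P \<and>
     disjoint_family_on (class_items P) (classes P) \<and>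
     (\<forall>c\<in>classes P. class_items P c \<noteq> {}) \<and>
     (\<forall>c\<in>classes P. setup_weight P c \<ge> 0) \<and>
     (\<forall>c\<in>classes P. setup_cost P c \<ge> 0) \<and>
     bin_cost P \<ge> 1 \<and>
     (\<forall>c\<in>classes P. \<forall>i\<in>class_items P c. weight P i + setup_weight P c \<le> capacity P) \<and>
     (\<Sum>i\<in>items P. weight P i) + (\<Sum>c\<in>classes P. setup_weight P c) > capacity P"

definition classes_of :: "bpps \<Rightarrow> nat set \<Rightarrow> nat set" where
  "classes_of P S = {c \<in> classes P. S \<inter> class_items P c \<noteq> {}}"

definition packing_pattern :: "bpps \<Rightarrow> nat set \<Rightarrow> bool" where
  "packing_pattern P S \<longleftrightarrow>
     S \<subseteq> items P \<and>
     (\<Sum>i\<in>S. weight P i) + (\<Sum>c\<in>classes_of P S. setup_weight P c) \<le> capacity P"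

definition bpps_solution :: "bpps \<Rightarrow> nat set set \<Rightarrow> bool" where
  "bpps_solution P \<S> \<longleftrightarrow> partition_on (items P) \<S> \<and> (\<forall>S\<in>\<S>. packing_pattern P S)"

definition solution_cost :: "bpps \<Rightarrow> nat set set \<Rightarrow> int" where
  "solution_cost P \<S> =
     bin_cost P * int (card \<S>) + (\<Sum>S\<in>\<S>. \<Sum>c\<in>classes_of P S. setup_cost P c)"

definition optimal_solution :: "bpps \<Rightarrow> nat set set \<Rightarrow> bool" where
  "optimal_solution P \<S> \<longleftrightarrow>
     bpps_solution P \<S> \<and> (\<forall>\<T>. bpps_solution P \<T> \<longrightarrow> solution_cost P \<S> \<le> solution_cost P \<T>)"

definition bins_upper_bound :: "bpps \<Rightarrow> nat \<Rightarrow> bool" where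
  "bins_upper_bound P k \<longleftrightarrow> k \<ge> 1 \<and> (\<forall>\<S>. optimal_solution P \<S> \<longrightarrow> card \<S> \<le> k)"

definition class_min_bins :: "bpps \<Rightarrow> nat \<Rightarrow> int" where
  "class_min_bins P c =
     \<lceil>real_of_int (\<Sum>i\<in>class_items P c. weight P i) / real_of_int (capacity P - setup_weight P c)\<rceil>"

definition ilp_feasible ::
    "bpps \<Rightarrow> nat \<Rightarrow> (nat \<Rightarrow> nat \<Rightarrow> int) \<Rightarrow> (nat \<Rightarrow> nat \<Rightarrow> int) \<Rightarrow> (nat \<Rightarrow> int) \<Rightarrow> bool" where
  "ilp_feasible P k x y z \<longleftrightarrow>
     (\<forall>i\<in>items P. (\<Sum>b\<in>{1..k}. x i b) = 1) \<and>
     (\<forall>b\<in>{1..k}. (\<Sum>i\<in>items P. weight P i * x i b) + (\<Sum>c\<in>classes P. setup_weight P c * y c b)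
                    \<le> capacity P * z b) \<and>
     (\<forall>c\<in>classes P. \<forall>i\<in>class_items P c. \<forall>b\<in>{1..k}. x i b \<le> y c b) \<and>
     (\<forall>i\<in>items P. \<forall>b\<in>{1..k}. x i b \<in> {0, 1}) \<and>
     (\<forall>c\<in>classes P. \<forall>b\<in>{1..k}. y c b \<in> {0, 1}) \<and>
     (\<forall>b\<in>{1..k}. z b \<in> {0, 1})"

end

theory Submission
  imports Defs
begin

text \<open>A bin opened for class \<open>c\<close> has room at most \<open>d - s\<^sub>c\<close> for the items of that class, so
  class \<open>c\<close> is set up in at least \<open>\<gamma>\<^sub>c\<close> bins. Summing the capacity constraints over all bins then
  bounds \<open>d\<close> times the number of bins from below by the total weight of the items and setups.\<close>

text \<open>Removes the division from both ceilings, the one in \<open>class_min_bins\<close> and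
  the one in the final bound, leaving inequalities between integers.\<close>

lemma ceiling_divide_le_iff:
  fixes a b n :: int
  assumes "b > 0"
  shows "\<lceil>real_of_int a / real_of_int b\<rceil> \<le> n \<longleftrightarrow> a \<le> b * n"
proof -
  have "\<lceil>real_of_int a / real_of_int b\<rceil> \<le> n \<longleftrightarrow> real_of_int a \<le> real_of_int (b * n)"
    using assms by (simp add: ceiling_le_iff pos_divide_le_eq mult.commute)
  then show ?thesis
    by (simp only: of_int_le_iff)
qed

text \<open>If \<open>y c b = 0\<close>, the linking constraints force every \<open>x i b\<close> of
  the class to 0; if \<open>y c b = 1\<close>, the capacity constraint with
  \<open>z b \<le> 1\<close> applies. The factor \<open>y c b\<close> covers both cases in one
  linear bound that can be summed over the bins.\<close>

lemma class_load_le: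
  assumes "bpps_instance P" and "ilp_feasible P k x y z"
    and c: "c \<in> classes P" and b: "b \<in> {1..k}"
  shows "(\<Sum>i\<in>class_items P c. weight P i * x i b) \<le> (capacity P - setup_weight P c) * y c b"
proof -
  note inst = assms(1)[unfolded bpps_instance_def] and feas = assms(2)[unfolded ilp_feasible_def]
  have sub: "class_items P c \<subseteq> items P"
    using inst c by blast
  have x01: "x i b \<in> {0, 1}" if "i \<in> items P" for i
    using feas b that by blast
  have y01: "y c' b \<in> {0, 1}" if "c' \<in> classes P" for c'
    using feas b that by blast
  have xy: "x i b \<le> y c b" if "i \<in> class_items P c" for i
    using feas b c that by blast
  show ?thesis
  proof (cases "y c b = 0")
    case True
    have "x i b = 0" if "i \<in> class_items P c" for i
      using xy[OF that] x01[of i] sub that True by auto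
    then show ?thesis
      using True by simp
  next
    case False
    then have y1: "y c b = 1"
      using y01[OF c] by auto
    \<comment> \<open>Passing to one class and its own setup drops only nonnegative terms from the
      capacity constraint.\<close>
    have "(\<Sum>i\<in>class_items P c. weight P i * x i b) \<le> (\<Sum>i\<in>items P. weight P i * x i b)"
    proof (rule sum_mono2[OF _ sub])
      show "finite (items P)"
        by (simp add: items_def)
      show "0 \<le> weight P i * x i b" if "i \<in> items P - class_items P c" for i
        using inst x01[of i] that by force
    qed
    moreover have "setup_weight P c * y c b \<le> (\<Sum>c\<in>classes P. setup_weight P c * y c b)"
    proof (rule member_le_sum[OF c])
      show "finite (classes P)"
        by (simp add: classes_def)
      show "0 \<le> setup_weight P c' * y c' b" if "c' \<in> classes P - {c}" for c'
        using inst y01[of c'] that by auto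
    qed
    moreover have "(\<Sum>i\<in>items P. weight P i * x i b) + (\<Sum>c\<in>classes P. setup_weight P c * y c b)
        \<le> capacity P * z b"
      using feas b by blast
    moreover have "z b \<in> {0, 1}"
      using feas b by blast
    then have "capacity P * z b \<le> capacity P"
      using inst by auto
    ultimately show ?thesis
      using y1 by simp
  qed
qed

text \<open>After exchanging the sums, each item's assignments add up to 1. A general
  \<open>A\<close> serves both a single class and the set of all items.\<close>

lemma sum_weighted_assignment:
  assumes "ilp_feasible P k x y z" and "A \<subseteq> items P"
  shows "(\<Sum>b\<in>{1..k}. \<Sum>i\<in>A. weight P i * x i b) = (\<Sum>i\<in>A. weight P i)"
proof -
  have "(\<Sum>b\<in>{1..k}. \<Sum>i\<in>A. weight P i * x i b) = (\<Sum>i\<in>A. weight P i * (\<Sum>b\<in>{1..k}. x i b))"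
    by (subst sum.swap) (simp add: sum_distrib_left)
  also have "\<dots> = (\<Sum>i\<in>A. weight P i)"
    using assms unfolding ilp_feasible_def by (intro sum.cong) auto
  finally show ?thesis .
qed

text \<open>Summing \<open>class_load_le\<close> over the bins bounds the class weight by
  \<open>capacity P - setup_weight P c\<close> times the number of setups. That number is an
  integer, so the quotient may be rounded up.\<close>

lemma class_min_bins_le:
  assumes "bpps_instance P" and "ilp_feasible P k x y z" and c: "c \<in> classes P"
  shows "class_min_bins P c \<le> (\<Sum>b\<in>{1..k}. y c b)"
proof -
  note inst = assms(1)[unfolded bpps_instance_def]
  have sub: "class_items P c \<subseteq> items P"
    using inst c by blast
  \<comment> \<open>Some item of positive weight fits beside the setup, so the divisor is
    positive.\<close>
  obtain i where i: "i \<in> class_items P c"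
    using inst c by blast
  then have "weight P i \<ge> 1" "weight P i + setup_weight P c \<le> capacity P"
    using inst c sub by blast+
  then have pos: "capacity P - setup_weight P c > 0"
    by linarith
  have "(\<Sum>i\<in>class_items P c. weight P i)
      = (\<Sum>b\<in>{1..k}. \<Sum>i\<in>class_items P c. weight P i * x i b)"
    using sum_weighted_assignment[OF assms(2) sub] by simp
  also have "\<dots> \<le> (\<Sum>b\<in>{1..k}. (capacity P - setup_weight P c) * y c b)"
    by (intro sum_mono class_load_le[OF assms])
  finally show ?thesis
    unfolding class_min_bins_def ceiling_divide_le_iff[OF pos] by (simp add: sum_distrib_left)
qed

theorem proposition7:
  fixes P :: bpps and k :: nat
    and x y :: "nat \<Rightarrow> nat \<Rightarrow> int" and z :: "nat \<Rightarrow> int"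
  assumes "bpps_instance P"
    and "bins_upper_bound P k"
    and "ilp_feasible P k x y z"
  shows "(\<Sum>b\<in>{1..k}. z b) \<ge>
    \<lceil>real_of_int ((\<Sum>i\<in>items P. weight P i) + (\<Sum>c\<in>classes P. class_min_bins P c * setup_weight P c))
      / real_of_int (capacity P)\<rceil>"
proof -
  have pos: "capacity P > 0"
    using assms(1) unfolding bpps_instance_def by linarith
  \<comment> \<open>Nonnegative setup weights preserve the bound on the number of setups of each
    class.\<close>
  have "(\<Sum>c\<in>classes P. class_min_bins P c * setup_weight P c)
      \<le> (\<Sum>c\<in>classes P. (\<Sum>b\<in>{1..k}. y c b) * setup_weight P c)"
    using assms(1) class_min_bins_le[OF assms(1,3)] unfolding bpps_instance_def
    by (intro sum_mono mult_right_mono) auto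
  \<comment> \<open>Regrouping the setups by bin matches the left sides of the capacity
    constraints.\<close>
  also have "\<dots> = (\<Sum>b\<in>{1..k}. \<Sum>c\<in>classes P. setup_weight P c * y c b)"
    by (subst sum.swap) (simp add: sum_distrib_left mult.commute)
  finally have "(\<Sum>i\<in>items P. weight P i) + (\<Sum>c\<in>classes P. class_min_bins P c * setup_weight P c)
      \<le> (\<Sum>b\<in>{1..k}. (\<Sum>i\<in>items P. weight P i * x i b)
          + (\<Sum>c\<in>classes P. setup_weight P c * y c b))"
    using sum_weighted_assignment[OF assms(3) subset_refl] by (simp add: sum.distrib)
  also have "\<dots> \<le> (\<Sum>b\<in>{1..k}. capacity P * z b)"
    using assms(3) unfolding ilp_feasible_def by (intro sum_mono) blast
  finally show ?thesis
    unfolding ceiling_divide_le_iff[OF pos] by (simp add: sum_distrib_left)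
qed

end
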